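(* Let $\mathcal M$ be a topological $\mathcal A$-module without torsion (multiplication by $\nu$ on $\mathcal M$ is injective). Then its Poisson characteristic variety $V\!A(\mathcal M)$ is a Poisson subvariety of $V^{\mathbb C}$.
   Context: Setting. $V=\mathbb R^d$ carries a polynomial Poisson structure (a bivector field $P$ with real polynomial coefficients and $[P,P]=0$). $A=\mathbb C[x_1,\dots,x_d]$ is the algebra of polynomials on $V^{\mathbb C}=\mathbb C^d$, with the Poisson bracket $\{\cdot,\cdot\}$ extended $\mathbb C$-bilinearly. $\mathcal A=A[[\nu]]$ is equipped with the Duflo–Kontsevich star product $*$: an associative $\mathbb C[[\nu]]$-bilinear product given for $f,g\in A$ by $f*g=fg+\sum_{k\ge1}\nu^kC_k(f,g)$, where the $C_k$ are bidifferential operators with real polynomial coefficients and $f*g-g*f=\nu\{f,g\}+O(\nu^2)$; it is equivalent to Kontsevich's star product and satisfies $f*g=fg$ for $f,g$ in the center of $(\mathcal A,* )$. One identifies $A$ with $\mathcal A/\nu\mathcal A$. A topological $\mathcal A$-module is a $\mathbb C[[\nu]]$-module $\mathcal M$ with a $\mathbb C[[\nu]]$-bilinear map $\mathcal A\times\mathcal M\to\mathcal M$, $(\varphi,m)\mapsto\pi_\nu(\varphi)m$, making it a left $\mathcal A$-module. $\operatorname{Ann}\mathcal M=\{\varphi\in\mathcal A:\pi_\nu(\varphi)m=0\ \forall m\in\mathcal M\}$. The Poisson characteristic variety $V\!A(\mathcal M)\subset V^{\mathbb C}$ is the set of common zeros of the ideal $\operatorname{Ann}\mathcal M/(\operatorname{Ann}\mathcal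 M\cap\nu\mathcal A)$ of $A$, i.e. of the set of constant terms $\varphi_0$ of elements $\varphi=\varphi_0+\nu\varphi_1+\cdots\in\operatorname{Ann}\mathcal M$. A Poisson subvariety of $V^{\mathbb C}$ is a Zariski-closed subset which, together with each of its points $x$, contains the whole symplectic leaf of $V^{\mathbb C}$ through $x$ (the set of points reachable from $x$ by finite compositions of local holomorphic flows of Hamiltonian vector fields $H_g=\{g,\cdot\}$, $g\in A$). *)

theory Defs
  imports
    "HOL-Analysis.Analysis"
    "HOL-Library.Poly_Mapping"
    "HOL-Computational_Algebra.Formal_Power_Series"
begin

section \<open>Polynomials on \<open>\<complex>\<^sup>d\<close>\<close>

text \<open>
  The coordinates are indexed by a finite type \<open>'n\<close> with \<open>d = CARD('n)\<close>. A polynomial maps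
  exponent vectors to coefficients; the ring structure is the convolution product on
  \<open>\<Rightarrow>\<^sub>0\<close>. The algebra \<open>A\<close> is the type \<open>'n cpoly\<close> and \<open>A[[\<nu>]]\<close> is the type
  \<open>'n cpoly fps\<close>, with \<open>\<nu>\<close> the variable \<^const>\<open>fps_X\<close>.
\<close>

type_synonym 'n cpoly = "('n \<Rightarrow>\<^sub>0 nat) \<Rightarrow>\<^sub>0 complex"

definition pvar :: "'n \<Rightarrow> 'n cpoly" where
  "pvar i = Poly_Mapping.single (Poly_Mapping.single i 1) 1"

definition pconst :: "complex \<Rightarrow> 'n cpoly" where
  "pconst c = Poly_Mapping.single 0 c"

definition peval :: "'n::finite cpoly \<Rightarrow> complex ^ 'n \<Rightarrow> complex" where
  "peval p x = (\<Sum>m\<in>Poly_Mapping.keys p.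
     Poly_Mapping.lookup p m * (\<Prod>i\<in>UNIV. (x $ i) ^ Poly_Mapping.lookup m i))"

definition pdiff :: "'n \<Rightarrow> 'n cpoly \<Rightarrow> 'n cpoly" where
  "pdiff i p = (\<Sum>m\<in>Poly_Mapping.keys p.
     Poly_Mapping.single (m - Poly_Mapping.single i 1)
       (of_nat (Poly_Mapping.lookup m i) * Poly_Mapping.lookup p m))"

definition pdiffs :: "'n list \<Rightarrow> 'n cpoly \<Rightarrow> 'n cpoly" where
  "pdiffs is p = foldr pdiff is p"

definition real_poly :: "'n cpoly \<Rightarrow> bool" where
  "real_poly p \<longleftrightarrow> (\<forall>m. Poly_Mapping.lookup p m \<in> \<real>)"

definition diff_operator :: "('n cpoly \<Rightarrow> 'n cpoly) \<Rightarrow> bool" where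
  "diff_operator D \<longleftrightarrow>
     (\<exists>S c. finite S \<and> (\<forall>f. D f = (\<Sum>a\<in>S. c a * pdiffs a f)))"

definition real_bidiff_operator :: "('n cpoly \<Rightarrow> 'n cpoly \<Rightarrow> 'n cpoly) \<Rightarrow> bool" where
  "real_bidiff_operator C \<longleftrightarrow>
     (\<exists>S c. finite S \<and> (\<forall>ab\<in>S. real_poly (c ab)) \<and>
        (\<forall>f g. C f g = (\<Sum>(a, b)\<in>S. c (a, b) * pdiffs a f * pdiffs b g)))"


section \<open>Poisson structures, Hamiltonian flows and symplectic leaves\<close>

text \<open>\<open>P\<close> is the matrix of coefficients of the bivector field; the last condition says that
  the components of the Schouten bracket \<open>[P,P]\<close> vanish.\<close>

definition poisson_structure :: "('n::finite \<Rightarrow> 'n \<Rightarrow> 'n cpoly) \<Rightarrow> bool" where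
  "poisson_structure P \<longleftrightarrow>
     (\<forall>i j. real_poly (P i j)) \<and>
     (\<forall>i j. P i j = - P j i) \<and>
     (\<forall>i j k. (\<Sum>l\<in>UNIV. P i l * pdiff l (P j k) + P j l * pdiff l (P k i)
                        + P k l * pdiff l (P i j)) = 0)"

definition pbracket :: "('n::finite \<Rightarrow> 'n \<Rightarrow> 'n cpoly) \<Rightarrow> 'n cpoly \<Rightarrow> 'n cpoly \<Rightarrow> 'n cpoly" where
  "pbracket P f g = (\<Sum>i\<in>UNIV. \<Sum>j\<in>UNIV. P i j * pdiff i f * pdiff j g)"

definition ham_field ::
    "('n::finite \<Rightarrow> 'n \<Rightarrow> 'n cpoly) \<Rightarrow> 'n cpoly \<Rightarrow> complex ^ 'n \<Rightarrow> complex ^ 'n" where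
  "ham_field P g x = (\<chi> j. peval (pbracket P g (pvar j)) x)"

text \<open>\<open>\<Phi>\<close> is the flow, for times \<open>\<bar>t\<bar> < r\<close> and starting points in \<open>W\<close>, of the Hamiltonian field of
  \<open>g\<close>. Holomorphy in \<open>(t, y)\<close> means real differentiability with complex-linear derivative.\<close>

definition local_ham_flow ::
    "('n::finite \<Rightarrow> 'n \<Rightarrow> 'n cpoly) \<Rightarrow> 'n cpoly \<Rightarrow> real \<Rightarrow> (complex ^ 'n) set \<Rightarrow>
     (complex \<Rightarrow> complex ^ 'n \<Rightarrow> complex ^ 'n) \<Rightarrow> bool" where
  "local_ham_flow P g r W \<Phi> \<longleftrightarrow>
     r > 0 \<and> open W \<and> (\<forall>y\<in>W. \<Phi> 0 y = y) \<and>
     (\<forall>t\<in>ball 0 r. \<forall>y\<in>W. \<exists>D.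
        ((\<lambda>(s, z). \<Phi> s z) has_derivative D) (at (t, y)) \<and>
        (\<forall>c a v. D (c * a, c *s v) = c *s D (a, v))) \<and>
     (\<forall>t\<in>ball 0 r. \<forall>y\<in>W. \<forall>j.
        ((\<lambda>s. \<Phi> s y $ j) has_field_derivative ham_field P g (\<Phi> t y) $ j) (at t))"

definition ham_step ::
    "('n::finite \<Rightarrow> 'n \<Rightarrow> 'n cpoly) \<Rightarrow> complex ^ 'n \<Rightarrow> complex ^ 'n \<Rightarrow> bool" where
  "ham_step P x y \<longleftrightarrow>
     (\<exists>g r W \<Phi> t. local_ham_flow P g r W \<Phi> \<and> x \<in> W \<and> t \<in> ball 0 r \<and> y = \<Phi> t x)"

definition symplectic_leaf ::
    "('n::finite \<Rightarrow> 'n \<Rightarrow> 'n cpoly) \<Rightarrow> complex ^ 'n \<Rightarrow> (complex ^ 'n) set" where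
  "symplectic_leaf P x = {y. (ham_step P)\<^sup>*\<^sup>* x y}"

definition common_zeros :: "'n::finite cpoly set \<Rightarrow> (complex ^ 'n) set" where
  "common_zeros S = {x. \<forall>p\<in>S. peval p x = 0}"

definition zariski_closed :: "(complex ^ 'n::finite) set \<Rightarrow> bool" where
  "zariski_closed X \<longleftrightarrow> (\<exists>S. X = common_zeros S)"

definition poisson_subvariety ::
    "('n::finite \<Rightarrow> 'n \<Rightarrow> 'n cpoly) \<Rightarrow> (complex ^ 'n) set \<Rightarrow> bool" where
  "poisson_subvariety P X \<longleftrightarrow>
     zariski_closed X \<and> (\<forall>x\<in>X. symplectic_leaf P x \<subseteq> X)"


section \<open>Kontsevich's star product\<close>

text \<open>
  A graph with \<open>k\<close> aerial vertices \<open>0, \<dots>, k - 1\<close> and two ground vertices, \<open>k\<close> (for the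
  left factor) and \<open>k + 1\<close> (for the right factor). The edges \<open>2 * v\<close> and \<open>2 * v + 1\<close> start at
  the aerial vertex \<open>v\<close>, so that edge \<open>e\<close> starts at \<open>e div 2\<close>; a graph is the function giving
  the endpoint of each edge, without loops.
\<close>

definition kgraphs :: "nat \<Rightarrow> (nat \<Rightarrow> nat) set" where
  "kgraphs k = PiE {..<2 * k} (\<lambda>e. {..<k + 2} - {e div 2})"

text \<open>The ground vertices are placed at \<open>0\<close> and \<open>1\<close>, the aerial ones in the upper half plane.
  The real coordinates \<open>2 * v\<close> and \<open>2 * v + 1\<close> are the real and imaginary parts of the position
  of \<open>v\<close>; \<open>kvel\<close> is the derivative of the position of \<open>v\<close> in the coordinate \<open>c\<close>.\<close>

definition kpos :: "nat \<Rightarrow> (nat \<Rightarrow> complex) \<Rightarrow> nat \<Rightarrow> complex" where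
  "kpos k p v = (if v < k then p v else if v = k then 0 else 1)"

definition kvel :: "nat \<Rightarrow> nat \<Rightarrow> nat \<Rightarrow> complex" where
  "kvel k v c = (if v < k \<and> v = c div 2 then (if even c then 1 else \<i>) else 0)"

text \<open>The differential of the hyperbolic angle \<open>arg ((q - p) / (q - cnj p))\<close> at \<open>(p, q)\<close>
  in the direction \<open>(dp, dq)\<close>, without a choice of branch.\<close>

definition dangle :: "complex \<Rightarrow> complex \<Rightarrow> complex \<Rightarrow> complex \<Rightarrow> real" where
  "dangle p q dp dq = Im ((dq - dp) / (q - p) - (dq - cnj dp) / (q - cnj p))"

definition kjacobian :: "nat \<Rightarrow> (nat \<Rightarrow> nat) \<Rightarrow> (nat \<Rightarrow> complex) \<Rightarrow> nat \<Rightarrow> nat \<Rightarrow> real" where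
  "kjacobian k \<gamma> p e c =
     dangle (kpos k p (e div 2)) (kpos k p (\<gamma> e)) (kvel k (e div 2) c) (kvel k (\<gamma> e) c)"

text \<open>The integral of the wedge product of the \<open>2 * k\<close> angle forms over the configurations of
  \<open>k\<close> points of the upper half plane (coincident points form a null set).\<close>

definition kweight :: "nat \<Rightarrow> (nat \<Rightarrow> nat) \<Rightarrow> real" where
  "kweight k \<gamma> = 1 / (fact k * (2 * pi) ^ (2 * k)) *
     (LINT p : {p. \<forall>v<k. Im (p v) > 0} | PiM {..<k} (\<lambda>_. lborel).
        (\<Sum>\<sigma> | \<sigma> permutes {..<2 * k}.
           of_int (sign \<sigma>) * (\<Prod>e<2 * k. kjacobian k \<gamma> p e (\<sigma> e))))"

definition kincoming :: "nat \<Rightarrow> (nat \<Rightarrow> nat) \<Rightarrow> nat \<Rightarrow> nat list" where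
  "kincoming k \<gamma> v = filter (\<lambda>e. \<gamma> e = v) [0..<2 * k]"

definition kgraph_operator ::
    "('n::finite \<Rightarrow> 'n \<Rightarrow> 'n cpoly) \<Rightarrow> nat \<Rightarrow> (nat \<Rightarrow> nat) \<Rightarrow> 'n cpoly \<Rightarrow> 'n cpoly \<Rightarrow> 'n cpoly" where
  "kgraph_operator \<alpha> k \<gamma> f g =
     (\<Sum>I\<in>PiE {..<2 * k} (\<lambda>_. UNIV).
        (\<Prod>v<k. pdiffs (map I (kincoming k \<gamma> v)) (\<alpha> (I (2 * v)) (I (2 * v + 1)))) *
        pdiffs (map I (kincoming k \<gamma> k)) f *
        pdiffs (map I (kincoming k \<gamma> (k + 1))) g)"

text \<open>Kontsevich's formula reads \<open>f * g = f g + \<hbar> \<alpha>(df, dg) + O(\<hbar>\<^sup>2)\<close>. The normalisation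
  \<open>f * g - g * f = \<nu> {f, g} + O(\<nu>\<^sup>2)\<close> amounts to \<open>\<hbar> = \<nu> / 2\<close>, whence the factor \<open>(1/2) ^ k\<close>.\<close>

definition kontsevich_operator ::
    "('n::finite \<Rightarrow> 'n \<Rightarrow> 'n cpoly) \<Rightarrow> nat \<Rightarrow> 'n cpoly \<Rightarrow> 'n cpoly \<Rightarrow> 'n cpoly" where
  "kontsevich_operator P k f g =
     (\<Sum>\<gamma>\<in>kgraphs k. pconst (of_real ((1 / 2) ^ k * kweight k \<gamma>)) * kgraph_operator P k \<gamma> f g)"

definition kontsevich_star ::
    "('n::finite \<Rightarrow> 'n \<Rightarrow> 'n cpoly) \<Rightarrow> 'n cpoly fps \<Rightarrow> 'n cpoly fps \<Rightarrow> 'n cpoly fps" where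
  "kontsevich_star P \<phi> \<psi> = Abs_fps (\<lambda>n. \<Sum>k\<le>n. \<Sum>i\<le>n - k.
     kontsevich_operator P k (fps_nth \<phi> i) (fps_nth \<psi> (n - k - i)))"


section \<open>Star products of Duflo--Kontsevich type\<close>

text \<open>\<open>T = id + \<nu> T\<^sub>1 + \<nu>\<^sup>2 T\<^sub>2 + \<dots>\<close> with differential operators \<open>T\<^sub>k\<close>, applied to a series.\<close>

definition apply_series :: "(nat \<Rightarrow> 'n cpoly \<Rightarrow> 'n cpoly) \<Rightarrow> 'n cpoly fps \<Rightarrow> 'n cpoly fps" where
  "apply_series T \<phi> = Abs_fps (\<lambda>n. \<Sum>k\<le>n. T k (fps_nth \<phi> (n - k)))"

definition star_equivalent ::
    "('n cpoly fps \<Rightarrow> 'n cpoly fps \<Rightarrow> 'n cpoly fps) \<Rightarrow>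
     ('n cpoly fps \<Rightarrow> 'n cpoly fps \<Rightarrow> 'n cpoly fps) \<Rightarrow> bool" where
  "star_equivalent s s' \<longleftrightarrow>
     (\<exists>T. T 0 = id \<and> (\<forall>k. diff_operator (T k)) \<and>
        (\<forall>\<phi> \<psi>. apply_series T (s \<phi> \<psi>) = s' (apply_series T \<phi>) (apply_series T \<psi>)))"

text \<open>The action of the scalars \<open>\<complex>[[\<nu>]]\<close> on \<open>A[[\<nu>]]\<close>.\<close>

definition nu_scale :: "complex fps \<Rightarrow> 'n cpoly fps \<Rightarrow> 'n cpoly fps" where
  "nu_scale c \<phi> = Abs_fps (\<lambda>n. pconst (fps_nth c n)) * \<phi>"

definition star_center :: "('n cpoly fps \<Rightarrow> 'n cpoly fps \<Rightarrow> 'n cpoly fps) \<Rightarrow> 'n cpoly fps set" where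
  "star_center s = {\<phi>. \<forall>\<psi>. s \<phi> \<psi> = s \<psi> \<phi>}"

locale duflo_kontsevich_star =
  fixes P :: "'n::finite \<Rightarrow> 'n \<Rightarrow> 'n cpoly"
    and star :: "'n cpoly fps \<Rightarrow> 'n cpoly fps \<Rightarrow> 'n cpoly fps"
  assumes star_add_left: "star (\<phi> + \<phi>') \<psi> = star \<phi> \<psi> + star \<phi>' \<psi>"
    and star_add_right: "star \<phi> (\<psi> + \<psi>') = star \<phi> \<psi> + star \<phi> \<psi>'"
    and star_scale_left: "star (nu_scale c \<phi>) \<psi> = nu_scale c (star \<phi> \<psi>)"
    and star_scale_right: "star \<phi> (nu_scale c \<psi>) = nu_scale c (star \<phi> \<psi>)"
    and star_assoc: "star (star \<phi> \<psi>) \<rho> = star \<phi> (star \<psi> \<rho>)"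
    and star_expansion:
      "\<exists>C. (\<forall>k\<ge>1. real_bidiff_operator (C k)) \<and>
         (\<forall>f g. star (fps_const f) (fps_const g) =
            Abs_fps (\<lambda>k. if k = 0 then f * g else C k f g))"
    and star_commutator:
      "fps_nth (star (fps_const f) (fps_const g) - star (fps_const g) (fps_const f)) 1
         = pbracket P f g"
    and star_equivalent_kontsevich: "star_equivalent star (kontsevich_star P)"
    and star_on_center:
      "\<phi> \<in> star_center star \<Longrightarrow> \<psi> \<in> star_center star \<Longrightarrow> star \<phi> \<psi> = \<phi> * \<psi>"


section \<open>Modules and the Poisson characteristic variety\<close>

text \<open>The constant series \<open>1\<close> is the unit of a star product of Duflo--Kontsevich type: a unit exists
  by equivalence with Kontsevich's product, it is
  central and invertible in \<open>A[[\<nu>]]\<close>, and its star square is its ordinary square.\<close>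

locale topological_star_module =
  module smul
  for star :: "'n::finite cpoly fps \<Rightarrow> 'n cpoly fps \<Rightarrow> 'n cpoly fps"
    and smul :: "complex fps \<Rightarrow> 'm::ab_group_add \<Rightarrow> 'm"
    and act :: "'n cpoly fps \<Rightarrow> 'm \<Rightarrow> 'm" +
  assumes act_add_left: "act (\<phi> + \<psi>) m = act \<phi> m + act \<psi> m"
    and act_add_right: "act \<phi> (m + m') = act \<phi> m + act \<phi> m'"
    and act_scale_left: "act (nu_scale c \<phi>) m = smul c (act \<phi> m)"
    and act_scale_right: "act \<phi> (smul c m) = smul c (act \<phi> m)"
    and act_star: "act (star \<phi> \<psi>) m = act \<phi> (act \<psi> m)"
    and act_one: "act 1 m = m"

definition annihilator :: "('n cpoly fps \<Rightarrow> 'm::ab_group_add \<Rightarrow> 'm) \<Rightarrow> 'n cpoly fps set" where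
  "annihilator act = {\<phi>. \<forall>m. act \<phi> m = 0}"

definition char_variety ::
    "('n::finite cpoly fps \<Rightarrow> 'm::ab_group_add \<Rightarrow> 'm) \<Rightarrow> (complex ^ 'n) set" where
  "char_variety act = common_zeros ((\<lambda>\<phi>. fps_nth \<phi> 0) ` annihilator act)"

end

(*
  The constant terms J of the annihilator are stable under {g, .} for every polynomial g: if phi
  annihilates M, then so does g * phi - phi * g = nu psi, hence so does psi because M has no
  torsion, and the constant term of psi is {g, phi_0}. Along a flow curve of H_g starting at a
  common zero of J, the n-th time derivative at 0 of p in J is the value of {g, {g, ... {g, p}}} in J
  at that point, that is 0. So p vanishes along the curve by the identity theorem, and no finite
  generation of J is needed.
*)

theory Submission
  imports Defs "HOL-Complex_Analysis.Cauchy_Integral_Formula"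
begin

section \<open>Evaluation of polynomials\<close>

lemma peval_superset:
  assumes "finite S" "Poly_Mapping.keys p \<subseteq> S"
  shows "peval p x = (\<Sum>m\<in>S. Poly_Mapping.lookup p m * (\<Prod>i\<in>UNIV. (x $ i) ^ Poly_Mapping.lookup m i))"
  unfolding peval_def
  by (rule sum.mono_neutral_left) (use assms in \<open>auto simp: in_keys_iff\<close>)

lemma peval_zero [simp]: "peval 0 x = 0"
  by (simp add: peval_def)

lemma peval_add: "peval (p + q) x = peval p x + peval q x"
proof -
  let ?S = "Poly_Mapping.keys p \<union> Poly_Mapping.keys q"
  show ?thesis
    using Poly_Mapping.keys_add[of p q]
    by (simp add: peval_superset[of ?S] lookup_add distrib_right sum.distrib)
qed

lemma peval_sum: "peval (\<Sum>a\<in>S. f a) x = (\<Sum>a\<in>S. peval (f a) x)"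
  by (induction S rule: infinite_finite_induct) (auto simp: peval_add)

lemma peval_single:
  "peval (Poly_Mapping.single m c) x = c * (\<Prod>i\<in>UNIV. (x $ i) ^ Poly_Mapping.lookup m i)"
  using peval_superset[of "{m}" "Poly_Mapping.single m c" x] by simp

lemma sum_monomials:
  fixes p :: "'a \<Rightarrow>\<^sub>0 'b::comm_monoid_add"
  shows "(\<Sum>m\<in>Poly_Mapping.keys p. Poly_Mapping.single m (Poly_Mapping.lookup p m)) = p"
  by (rule poly_mapping_eqI)
     (auto simp: lookup_sum lookup_single when_def in_keys_iff)

text \<open>Both factors split into monomials; for monomials the exponents add, and distributivity
  does the rest.\<close>

lemma peval_mult: "peval (p * q) x = peval p x * peval q x"
proof -
  let ?s = "\<lambda>p m. Poly_Mapping.single m (Poly_Mapping.lookup p m)"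
  have "peval (p * q) x =
      peval ((\<Sum>m\<in>Poly_Mapping.keys p. ?s p m) * (\<Sum>n\<in>Poly_Mapping.keys q. ?s q n)) x"
    by (simp add: sum_monomials)
  also have "\<dots> = (\<Sum>m\<in>Poly_Mapping.keys p. \<Sum>n\<in>Poly_Mapping.keys q.
      peval (?s p m) x * peval (?s q n) x)"
    by (simp add: sum_product peval_sum mult_single peval_single lookup_add power_add
        prod.distrib mult_ac)
  also have "\<dots> = peval p x * peval q x"
    unfolding peval_single by (simp add: peval_def sum_product)
  finally show ?thesis .
qed

lemma peval_pdiff_pvar: "peval (pdiff k (pvar j)) x = (if k = j then 1 else 0)"
  by (auto simp: pdiff_def pvar_def peval_single lookup_minus lookup_single)

text \<open>The bracket involves only first derivatives of \<open>p\<close>, so at a point it is the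
  derivative of \<open>p\<close> in the direction \<open>ham_field P g x\<close>. This form matches
  the chain rule below.\<close>

lemma peval_pbracket:
  "peval (pbracket P g p) x =
     (\<Sum>j\<in>UNIV. peval (pdiff j p) x * ham_field P g x $ j)"
proof -
  have "ham_field P g x $ j = (\<Sum>i\<in>UNIV. peval (P i j) x * peval (pdiff i g) x)" for j
    by (simp add: ham_field_def pbracket_def peval_sum peval_mult peval_pdiff_pvar
        if_distrib[of "(*) _"] cong: if_cong)
  then have "(\<Sum>j\<in>UNIV. peval (pdiff j p) x * ham_field P g x $ j) =
      (\<Sum>j\<in>UNIV. \<Sum>i\<in>UNIV. peval (P i j) x * peval (pdiff i g) x * peval (pdiff j p) x)"
    by (simp add: sum_distrib_left mult_ac)
  also have "\<dots> = peval (pbracket P g p) x"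
    by (subst sum.swap) (simp add: pbracket_def peval_sum peval_mult)
  finally show ?thesis by simp
qed

text \<open>Chain rule for a polynomial along a complex curve. It links the formal
  \<open>pdiff\<close> to the analytic derivative, one monomial at a time by the product
  rule.\<close>

lemma has_field_derivative_peval:
  fixes f :: "complex \<Rightarrow> complex ^ 'n::finite"
  assumes f: "\<And>j. ((\<lambda>s. f s $ j) has_field_derivative f' j) (at t)"
  shows "((\<lambda>s. peval p (f s)) has_field_derivative
           (\<Sum>j\<in>UNIV. peval (pdiff j p) (f t) * f' j)) (at t)"
proof -
  have monom: "((\<lambda>s. c * (\<Prod>i\<in>UNIV. (f s $ i) ^ Poly_Mapping.lookup m i)) has_field_derivative
      (\<Sum>j\<in>UNIV. peval (Poly_Mapping.single (m - Poly_Mapping.single j 1)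
         (of_nat (Poly_Mapping.lookup m j) * c)) (f t) * f' j)) (at t)"
    for c :: complex and m :: "'n \<Rightarrow>\<^sub>0 nat"
  proof -
    let ?m = "Poly_Mapping.lookup m"
    \<comment> \<open>Truncated subtraction is harmless: if the exponent \<open>?m j\<close> is 0,
      both sides carry the factor \<open>of_nat 0\<close>.\<close>
    have eq: "c * ((of_nat (?m j) * (f t $ j) ^ (?m j - 1) * f' j) * (\<Prod>i\<in>UNIV - {j}. (f t $ i) ^ ?m i)) =
        peval (Poly_Mapping.single (m - Poly_Mapping.single j 1) (of_nat (?m j) * c)) (f t) * f' j" for j
    proof -
      have "(\<Prod>i\<in>UNIV. (f t $ i) ^ Poly_Mapping.lookup (m - Poly_Mapping.single j 1) i) =
          (f t $ j) ^ (?m j - 1) * (\<Prod>i\<in>UNIV - {j}. (f t $ i) ^ ?m i)"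
        by (subst prod.remove[of _ j])
           (auto simp: lookup_minus lookup_single when_def intro!: arg_cong2[where f="(*)"] prod.cong)
      then show ?thesis by (simp add: peval_single)
    qed
    have "((\<lambda>s. \<Prod>i\<in>UNIV. (f s $ i) ^ ?m i) has_field_derivative
       (\<Sum>j\<in>UNIV. (of_nat (?m j) * (f t $ j) ^ (?m j - 1) * f' j) * (\<Prod>i\<in>UNIV - {j}. (f t $ i) ^ ?m i))) (at t)"
      by (rule has_field_derivative_prod)
         (auto intro!: derivative_eq_intros f simp: mult_ac)
    from DERIV_cmult[OF this, of c] show ?thesis
      by (simp only: sum_distrib_left eq)
  qed
  have "((\<lambda>s. peval p (f s)) has_field_derivative
     (\<Sum>m\<in>Poly_Mapping.keys p. \<Sum>j\<in>UNIV. peval (Poly_Mapping.single (m - Poly_Mapping.single j 1)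
         (of_nat (Poly_Mapping.lookup m j) * Poly_Mapping.lookup p m)) (f t) * f' j)) (at t)"
    unfolding peval_def[of p] by (rule DERIV_sum) (rule monom)
  then show ?thesis
    by (subst (asm) sum.swap) (simp add: pdiff_def peval_sum sum_distrib_right)
qed


section \<open>Zeros along Hamiltonian flows\<close>

lemma common_zeros_local_ham_flow:
  assumes flow: "local_ham_flow P g r W \<Phi>" "x \<in> W" "t \<in> ball 0 r"
    and closed: "\<And>p. p \<in> J \<Longrightarrow> pbracket P g p \<in> J"
    and x: "x \<in> common_zeros J"
  shows "\<Phi> t x \<in> common_zeros J"
proof -
  have r: "r > 0" and start: "\<Phi> 0 x = x"
    using flow unfolding local_ham_flow_def by auto
  define u where "u p s = peval p (\<Phi> s x)" for p s
  \<comment> \<open>Differentiating in time replaces \<open>p\<close> by its bracket with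
    \<open>g\<close>.\<close>
  have u': "(u p has_field_derivative u (pbracket P g p) s) (at s)" if "s \<in> ball 0 r" for p s
    unfolding u_def peval_pbracket
    using flow that by (intro has_field_derivative_peval) (auto simp: local_ham_flow_def)
  \<comment> \<open>Claimed on the whole disc, since the induction step differentiates the
    hypothesis and so needs it in a neighbourhood of \<open>s\<close>.\<close>
  have higher: "(deriv ^^ n) (u p) s = u ((pbracket P g ^^ n) p) s" if "s \<in> ball 0 r" for n p s
    using that
  proof (induction n arbitrary: s)
    case (Suc n)
    have "\<forall>\<^sub>F z in nhds s. (deriv ^^ n) (u p) z = u ((pbracket P g ^^ n) p) z"
      by (rule eventually_nhds_in_open[of "ball 0 r" s, THEN eventually_mono])
         (use Suc in auto)
    then have "deriv ((deriv ^^ n) (u p)) s = deriv (u ((pbracket P g ^^ n) p)) s"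
      by (rule deriv_cong_ev) simp
    then show ?case
      using DERIV_imp_deriv[OF u'[OF Suc.prems]] by simp
  qed simp
  show ?thesis
    unfolding common_zeros_def
  proof safe
    fix p assume p: "p \<in> J"
    have "(pbracket P g ^^ n) p \<in> J" for n
      by (induction n) (use p closed in auto)
    then have "(deriv ^^ n) (u p) 0 = 0" for n
      using x r by (simp add: higher u_def start common_zeros_def)
    moreover have "u p holomorphic_on ball 0 r"
      unfolding holomorphic_on_open[OF open_ball] using u' by blast
    \<comment> \<open>The disc is connected, so a holomorphic function whose derivatives of every
      order vanish at the centre is zero on all of it.\<close>
    ultimately have "u p t = 0"
      using holomorphic_fun_eq_0_on_connected[of "u p" "ball 0 r" 0 t] r flow(3) by auto
    then show "peval p (\<Phi> t x) = 0"
      by (simp add: u_def)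
  qed
qed

text \<open>A point of the leaf is reached by a finite chain of local flows, and each link stays
  inside the common zeros.\<close>

lemma poisson_subvariety_common_zeros:
  assumes "\<And>g p. p \<in> J \<Longrightarrow> pbracket P g p \<in> J"
  shows "poisson_subvariety P (common_zeros J)"
proof -
  have "y \<in> common_zeros J" if "x \<in> common_zeros J" "(ham_step P)\<^sup>*\<^sup>* x y" for x y
    using that(2,1)
  proof induction
    case (step y z)
    then obtain g r W \<Phi> t
      where "local_ham_flow P g r W \<Phi>" "y \<in> W" "t \<in> ball 0 r" "z = \<Phi> t y"
      unfolding ham_step_def by blast
    then show ?case
      using common_zeros_local_ham_flow[of P g r W \<Phi> y t J] assms step by simp
  qed
  then show ?thesis
    by (auto simp: poisson_subvariety_def zariski_closed_def symplectic_leaf_def)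
qed


section \<open>Star commutators\<close>

lemma nu_scale_fps_X: "nu_scale fps_X \<phi> = fps_X * \<phi>"
proof -
  have "Abs_fps (\<lambda>n. pconst (fps_nth fps_X n)) = (fps_X :: 'a cpoly fps)"
    by (rule fps_ext) (auto simp: fps_X_def pconst_def)
  then show ?thesis by (simp add: nu_scale_def)
qed

text \<open>The low-order formulas for the star product are given on constants only; this splitting
  carries them over to arbitrary series.\<close>

lemma fps_decompose:
  fixes \<phi> :: "'a::comm_ring_1 fps"
  shows "\<phi> = fps_const (fps_nth \<phi> 0) + fps_X * fps_shift 1 \<phi>"
  by (rule fps_ext) auto

context duflo_kontsevich_star
begin

lemma star_const_nth_0: "fps_nth (star (fps_const f) (fps_const g)) 0 = f * g"
  using star_expansion by auto

lemma star_X_left: "star (fps_X * \<phi>) \<psi> = fps_X * star \<phi> \<psi>"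
  using star_scale_left[of fps_X] by (simp add: nu_scale_fps_X)

lemma star_X_right: "star \<phi> (fps_X * \<psi>) = fps_X * star \<phi> \<psi>"
  using star_scale_right[of _ fps_X] by (simp add: nu_scale_fps_X)

lemma star_nth_0_const_left: "fps_nth (star (fps_const g) \<phi>) 0 = g * fps_nth \<phi> 0"
  by (subst fps_decompose[of \<phi>]) (simp add: star_add_right star_X_right star_const_nth_0)

lemma star_nth_0_const_right: "fps_nth (star \<phi> (fps_const g)) 0 = fps_nth \<phi> 0 * g"
  by (subst fps_decompose[of \<phi>]) (simp add: star_add_left star_X_left star_const_nth_0)

text \<open>At order one, the tail of \<open>\<phi>\<close> enters only through the order-zero parts
  of its two products with \<open>g\<close>. These cancel because \<open>A\<close> is commutative,
  which leaves the commutator of constants.\<close>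

lemma star_commutator_nth_1:
  "fps_nth (star (fps_const g) \<phi> - star \<phi> (fps_const g)) 1 = pbracket P g (fps_nth \<phi> 0)"
proof -
  let ?g = "fps_const g" and ?f = "fps_const (fps_nth \<phi> 0)" and ?\<psi> = "fps_shift 1 \<phi>"
  have "star ?g \<phi> = star ?g ?f + fps_X * star ?g ?\<psi>"
    by (subst fps_decompose[of \<phi>]) (simp only: star_add_right star_X_right)
  moreover have "star \<phi> ?g = star ?f ?g + fps_X * star ?\<psi> ?g"
    by (subst fps_decompose[of \<phi>]) (simp only: star_add_left star_X_left)
  ultimately show ?thesis
    using star_commutator[of g "fps_nth \<phi> 0"]
    by (simp add: star_nth_0_const_left star_nth_0_const_right mult.commute)
qed

lemma star_commutator_divisible:
  obtains \<psi> where "star (fps_const g) \<phi> - star \<phi> (fps_const g) = fps_X * \<psi>"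
    and "fps_nth \<psi> 0 = pbracket P g (fps_nth \<phi> 0)"
proof -
  let ?c = "star (fps_const g) \<phi> - star \<phi> (fps_const g)"
  have "fps_nth ?c 0 = 0"
    by (simp add: star_nth_0_const_left star_nth_0_const_right mult.commute)
  then have "?c = fps_X * fps_shift 1 ?c"
    using fps_decompose[of ?c] by simp
  moreover have "fps_nth (fps_shift 1 ?c) 0 = pbracket P g (fps_nth \<phi> 0)"
    using star_commutator_nth_1[of g \<phi>] by simp
  ultimately show ?thesis by (rule that)
qed

end

context topological_star_module
begin

lemma act_zero_right [simp]: "act \<phi> 0 = 0"
  using act_add_right[of \<phi> 0 0] by simp

lemma act_diff_left: "act (\<phi> - \<psi>) m = act \<phi> m - act \<psi> m"
  using act_add_left[of "\<phi> - \<psi>" \<psi> m] by (simp add: eq_diff_eq)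

text \<open>In one product \<open>\<phi>\<close> kills \<open>m\<close> itself, in the other it
  kills \<open>act \<psi> m\<close>.\<close>

lemma commutator_in_annihilator:
  "\<phi> \<in> annihilator act \<Longrightarrow> star \<psi> \<phi> - star \<phi> \<psi> \<in> annihilator act"
  by (simp add: annihilator_def act_diff_left act_star)

text \<open>Scaling \<open>act \<psi> m\<close> by \<nu> gives the action of
  \<open>fps_X * \<psi>\<close> on \<open>m\<close>, which is 0; injectivity then gives
  \<open>act \<psi> m = 0\<close>.\<close>

lemma annihilator_divide_X:
  assumes "inj (smul fps_X)" "fps_X * \<psi> \<in> annihilator act"
  shows "\<psi> \<in> annihilator act"
proof -
  have "act \<psi> m = 0" for m
    by (rule injD[OF assms(1)])
       (use assms(2) act_scale_left[of fps_X \<psi> m] in \<open>simp add: annihilator_def nu_scale_fps_X\<close>)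
  then show ?thesis
    by (simp add: annihilator_def)
qed

end

theorem mainTheorem2:
  fixes P :: "'n::finite \<Rightarrow> 'n \<Rightarrow> 'n cpoly"
    and star :: "'n cpoly fps \<Rightarrow> 'n cpoly fps \<Rightarrow> 'n cpoly fps"
    and smul :: "complex fps \<Rightarrow> 'm::ab_group_add \<Rightarrow> 'm"
    and act :: "'n cpoly fps \<Rightarrow> 'm \<Rightarrow> 'm"
  assumes "poisson_structure P"
    and "duflo_kontsevich_star P star"
    and "topological_star_module star smul act"
    and torsion_free: "inj (smul fps_X)"
  shows "poisson_subvariety P (char_variety act)"
proof -
  interpret duflo_kontsevich_star P star by fact
  interpret topological_star_module star smul act by fact
  show ?thesis
    unfolding char_variety_def
  \<comment> \<open>What remains is stability of the set of constant terms under brackets with every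
    \<open>g\<close>.\<close>
  proof (rule poisson_subvariety_common_zeros)
    fix g p assume "p \<in> (\<lambda>\<phi>. fps_nth \<phi> 0) ` annihilator act"
    then obtain \<phi> where \<phi>: "\<phi> \<in> annihilator act" "p = fps_nth \<phi> 0"
      by blast
    obtain \<psi> where \<psi>: "star (fps_const g) \<phi> - star \<phi> (fps_const g) = fps_X * \<psi>"
        "fps_nth \<psi> 0 = pbracket P g p"
      using star_commutator_divisible[of g \<phi>] \<phi>(2) by metis
    \<comment> \<open>The absence of torsion removes the factor \<nu> from the commutator.\<close>
    have "\<psi> \<in> annihilator act"
      using annihilator_divide_X[OF torsion_free, of \<psi>]
        commutator_in_annihilator[OF \<phi>(1), of "fps_const g"] \<psi>(1) by simp
    then show "pbracket P g p \<in> (\<lambda>\<phi>. fps_nth \<phi> 0) ` annihilator act"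
      using \<psi>(2) by (metis image_eqI)
  qed
qed

end
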